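(* In the variety of $2$-dimensional commutative pre-Lie algebras over $\mathbb C$, write $\overline{O(C_i^{*})}$ for the closure of $\bigcup_{\alpha\in\mathbb C}O(C_i^{\alpha})$. Then, with $\alpha$ ranging over all of $\mathbb C$: (i) $\overline{O(C_{05}^{*})}$ contains the orbit closures of $C_{04},C_{03},C_{02},\mathbb C^8$; (ii) $\overline{O(C_{06}^{*})}$ contains the orbit closures of $C_{04},C_{03},C_{01},\mathbb C^8$; (iii) $\overline{O(C_{10}^{*})}$ contains the orbit closures of $C_{17}^{\alpha},C_{04},C_{03},\mathbb C^8$; (iv) $\overline{O(C_{12}^{*})}$ contains the orbit closures of $C_{17}^{\alpha},C_{04},C_{03},\mathbb C^8$; (v) $\overline{O(C_{15}^{*})}$ contains the orbit closures of $C_{17}^{\alpha},C_{16},C_{08},C_{06}^{2},C_{05}^{1/2},C_{03},\mathbb C^8$; (vi) $\overline{O(C_{17}^{*})}$ contains the orbit closures of $C_{03},\mathbb C^8$.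
   Context: A commutative pre-Lie algebra is a complex vector space with a commutative associative product $\cdot$ and a pre-Lie product $\circ$, i.e. a bilinear product with $(x\circ y)\circ z-(y\circ x)\circ z=x\circ(y\circ z)-y\circ(x\circ z)$, such that $x\circ(y\cdot z)=(x\circ y)\cdot z+y\cdot(x\circ z)$. Fix a $2$-dimensional complex vector space $V$ with basis $e_1,e_2$. A $2$-dimensional such algebra is viewed as a pair $(\mu,\mu')\in \mathrm{Bil}(V\times V,V)^2\cong\mathbb C^{16}$ ($\mu$ is $\cdot$, $\mu'$ is $\circ$). $\mathrm{GL}(V)$ acts by $(g*(\mu,\mu'))(x,y)=(g\mu(g^{-1}x,g^{-1}y),\,g\mu'(g^{-1}x,g^{-1}y))$; $O(T)$ is the orbit of a structure representing $T$; closures are Zariski closures. The algebras are (unlisted products are zero, $\cdot$ is commutative; $C_{01}$--$C_{08}$ have $\cdot=0$): $C_{01}: e_1\circ e_1=e_1+e_2,\ e_2\circ e_1=e_2$; $C_{02}: e_1\circ e_1=e_1+e_2,\ e_1\circ e_2=e_2$; $C_{03}: e_1\circ e_1=e_2$; $C_{04}: e_2\circ e_1=e_1$; $C_{05}^{\alpha}: e_1\circ e_1=e_1,\ e_1\circ e_2=\alpha e_2$; $C_{06}^{\alpha}: e_1\circ e_1=e_1,\ e_1\circ e_2=\alpha e_2,\ e_2\circ e_1=e_2$; $C_{08}: e_1\circ e_1=e_1,\ e_1\circ e_2=2e_2,\ e_2\circ e_1=\frac12 e_1+e_2,\ e_2\circ e_2=e_2$; $C_{10}^{\alpha}: e_1\cdot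 e_1=e_1,\ e_1\cdot e_2=e_2,\ e_1\circ e_2=\alpha e_2$; $C_{12}^{\alpha}: e_1\cdot e_1=e_1,\ e_1\circ e_2=\alpha e_2$; $C_{15}^{\alpha}: e_1\cdot e_1=e_2,\ e_1\circ e_1=\alpha e_1,\ e_1\circ e_2=2\alpha e_2,\ e_2\circ e_1=e_1+\alpha e_2,\ e_2\circ e_2=2e_2$; $C_{16}: e_1\cdot e_1=e_2,\ e_1\circ e_1=e_1,\ e_1\circ e_2=2e_2,\ e_2\circ e_1=e_2$; $C_{17}^{\alpha}: e_1\cdot e_1=e_2,\ e_1\circ e_1=\alpha e_2$; $\mathbb C^8$: the algebra with both products zero. *)

theory Defs
  imports "HOL-Analysis.Analysis"
begin

section \<open>Bilinear maps on a fixed plane\<close>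

text \<open>The plane \<open>V\<close> is \<^typ>\<open>complex ^ 2\<close> with its standard basis. Its complex scalar
  multiplication is \<^term>\<open>(*s)\<close>; the overloaded \<^term>\<open>(*\<^sub>R)\<close> is only the real one, so
  linearity is stated with \<^term>\<open>Vector_Spaces.linear (*s) (*s)\<close>.\<close>

type_synonym V = "complex ^ 2"
type_synonym bilpair = "(V \<Rightarrow> V \<Rightarrow> V) \<times> (V \<Rightarrow> V \<Rightarrow> V)"

abbreviation e1 :: V where "e1 \<equiv> axis 1 1"
abbreviation e2 :: V where "e2 \<equiv> axis 2 1"

definition complex_bilinear :: "(V \<Rightarrow> V \<Rightarrow> V) \<Rightarrow> bool" where
  "complex_bilinear m \<longleftrightarrow>
     (\<forall>x. Vector_Spaces.linear (*s) (*s) (\<lambda>y. m x y)) \<and>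
     (\<forall>y. Vector_Spaces.linear (*s) (*s) (\<lambda>x. m x y))"

definition bil_pairs :: "bilpair set" where
  "bil_pairs = {(m, p). complex_bilinear m \<and> complex_bilinear p}"

text \<open>\<open>bilmap a b c d\<close> is the bilinear map with values \<open>a, b, c, d\<close> at
  \<open>(e1, e1), (e1, e2), (e2, e1), (e2, e2)\<close>.\<close>

definition bilmap :: "V \<Rightarrow> V \<Rightarrow> V \<Rightarrow> V \<Rightarrow> V \<Rightarrow> V \<Rightarrow> V" where
  "bilmap a b c d x y =
     (x $ 1 * y $ 1) *s a + (x $ 1 * y $ 2) *s b + (x $ 2 * y $ 1) *s c + (x $ 2 * y $ 2) *s d"

lemma bilmap_basis:
  "bilmap a b c d e1 e1 = a" "bilmap a b c d e1 e2 = b"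
  "bilmap a b c d e2 e1 = c" "bilmap a b c d e2 e2 = d"
  by (simp_all add: bilmap_def axis_def vec_eq_iff)

lemma complex_bilinear_bilmap: "complex_bilinear (bilmap a b c d)"
  unfolding complex_bilinear_def bilmap_def
  by (auto intro!: Vector_Spaces.linear.intro vec.vector_space_axioms module_hom.intro
      vec.module_axioms module_hom_axioms.intro simp: vec_eq_iff algebra_simps)

section \<open>The Zariski topology\<close>

text \<open>Polynomial functions in the 16 structure constants, i.e. in the coordinates that identify
  \<^term>\<open>bil_pairs\<close> with affine 16-space.\<close>

inductive poly_fun :: "(bilpair \<Rightarrow> complex) \<Rightarrow> bool" where
  const: "poly_fun (\<lambda>_. c)"
| coord_fst: "poly_fun (\<lambda>A. fst A (axis i 1) (axis j 1) $ k)"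
| coord_snd: "poly_fun (\<lambda>A. snd A (axis i 1) (axis j 1) $ k)"
| add: "poly_fun f \<Longrightarrow> poly_fun g \<Longrightarrow> poly_fun (\<lambda>A. f A + g A)"
| mult: "poly_fun f \<Longrightarrow> poly_fun g \<Longrightarrow> poly_fun (\<lambda>A. f A * g A)"

definition zero_locus :: "(bilpair \<Rightarrow> complex) set \<Rightarrow> bilpair set" where
  "zero_locus F = {A \<in> bil_pairs. \<forall>f\<in>F. f A = 0}"

definition zariski :: "bilpair topology" where
  "zariski = topology (\<lambda>U. \<exists>F\<subseteq>Collect poly_fun. U = bil_pairs - zero_locus F)"

lemma istopology_zariski:
  "istopology (\<lambda>U. \<exists>F\<subseteq>Collect poly_fun. U = bil_pairs - zero_locus F)"
  unfolding istopology_def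
proof (intro conjI allI impI)
  fix S T
  assume "\<exists>F\<subseteq>Collect poly_fun. S = bil_pairs - zero_locus F"
    and "\<exists>F\<subseteq>Collect poly_fun. T = bil_pairs - zero_locus F"
  then obtain F G where F: "F \<subseteq> Collect poly_fun" "S = bil_pairs - zero_locus F"
    and G: "G \<subseteq> Collect poly_fun" "T = bil_pairs - zero_locus G"
    by blast
  let ?H = "{\<lambda>A. f A * g A | f g. f \<in> F \<and> g \<in> G}"
  have "?H \<subseteq> Collect poly_fun"
  proof
    fix h assume "h \<in> ?H"
    then obtain f g where "f \<in> F" "g \<in> G" and h: "h = (\<lambda>A. f A * g A)"
      by auto
    then have "poly_fun f" "poly_fun g"
      using F(1) G(1) by auto
    then show "h \<in> Collect poly_fun"
      unfolding h mem_Collect_eq by (rule poly_fun.mult)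
  qed
  moreover have "S \<inter> T = bil_pairs - zero_locus ?H"
  proof -
    have "zero_locus ?H = zero_locus F \<union> zero_locus G"
    proof
      show "zero_locus ?H \<subseteq> zero_locus F \<union> zero_locus G"
      proof
        fix A assume A: "A \<in> zero_locus ?H"
        have "f A * g A = 0" if "f \<in> F" "g \<in> G" for f g
        proof -
          have "(\<lambda>A. f A * g A) \<in> ?H"
            using that by auto
          moreover have "\<forall>h\<in>?H. h A = 0"
            using A unfolding zero_locus_def by (rule CollectE) (erule conjunct2)
          ultimately show ?thesis
            using bspec[of ?H "\<lambda>h. h A = 0" "\<lambda>A. f A * g A"] by simp
        qed
        then have "f A = 0 \<or> g A = 0" if "f \<in> F" "g \<in> G" for f g
          using that by (simp only: mult_eq_0_iff[symmetric])
        with A show "A \<in> zero_locus F \<union> zero_locus G"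
          unfolding zero_locus_def by blast
      qed
      show "zero_locus F \<union> zero_locus G \<subseteq> zero_locus ?H"
        unfolding zero_locus_def by auto
    qed
    then show ?thesis
      unfolding F(2) G(2) by blast
  qed
  ultimately show "\<exists>H\<subseteq>Collect poly_fun. S \<inter> T = bil_pairs - zero_locus H"
    by blast
next
  fix K
  assume K: "\<forall>S\<in>K. \<exists>F\<subseteq>Collect poly_fun. S = bil_pairs - zero_locus F"
  then obtain \<Phi> where \<Phi>: "\<And>S. S \<in> K \<Longrightarrow> \<Phi> S \<subseteq> Collect poly_fun"
    "\<And>S. S \<in> K \<Longrightarrow> S = bil_pairs - zero_locus (\<Phi> S)"
    by metis
  have "\<Union>K = (\<Union>S\<in>K. bil_pairs - zero_locus (\<Phi> S))"
    using \<Phi>(2) by auto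
  also have "\<dots> = bil_pairs - zero_locus (\<Union>S\<in>K. \<Phi> S)"
    unfolding zero_locus_def by blast
  finally show "\<exists>F\<subseteq>Collect poly_fun. \<Union>K = bil_pairs - zero_locus F"
    using \<Phi>(1) by (metis UN_least)
qed

lemma openin_zariski:
  "openin zariski U \<longleftrightarrow> (\<exists>F\<subseteq>Collect poly_fun. U = bil_pairs - zero_locus F)"
  unfolding zariski_def by (simp only: topology_inverse'[OF istopology_zariski])

lemma topspace_zariski: "topspace zariski = bil_pairs"
proof
  show "topspace zariski \<subseteq> bil_pairs"
    unfolding topspace_def openin_zariski by blast
  have "openin zariski bil_pairs"
    unfolding openin_zariski zero_locus_def
    by (rule exI[of _ "{\<lambda>_. 1}"]) (simp add: poly_fun.const)
  then show "bil_pairs \<subseteq> topspace zariski"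
    by (rule openin_subset)
qed

lemma closedin_zariski:
  "closedin zariski Z \<longleftrightarrow> (\<exists>F\<subseteq>Collect poly_fun. Z = zero_locus F)"
proof -
  have "zero_locus F \<subseteq> bil_pairs" for F
    unfolding zero_locus_def by blast
  then show ?thesis
    unfolding closedin_def openin_zariski topspace_zariski
    by (metis Diff_Diff_Int Int_absorb1)
qed

section \<open>Commutative pre-Lie algebras and orbits\<close>

definition comm_prelie :: "bilpair set" where
  "comm_prelie = {(m, p). complex_bilinear m \<and> complex_bilinear p \<and>
     (\<forall>x y. m x y = m y x) \<and>
     (\<forall>x y z. m (m x y) z = m x (m y z)) \<and>
     (\<forall>x y z. p (p x y) z - p (p y x) z = p x (p y z) - p y (p x z)) \<and>
     (\<forall>x y z. p x (m y z) = m (p x y) z + m y (p x z))}"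

definition gl_act :: "complex ^ 2 ^ 2 \<Rightarrow> bilpair \<Rightarrow> bilpair" where
  "gl_act g = (\<lambda>(m, p).
     (\<lambda>x y. g *v m (matrix_inv g *v x) (matrix_inv g *v y),
      \<lambda>x y. g *v p (matrix_inv g *v x) (matrix_inv g *v y)))"

definition orbit :: "bilpair \<Rightarrow> bilpair set" where
  "orbit A = {gl_act g A | g. invertible g}"

text \<open>Closures are taken in the variety of commutative pre-Lie structures with the topology
  induced by \<^const>\<open>zariski\<close>. As \<open>closure_of\<close> discards points outside the space, it matters that
  the orbits considered lie in the variety; see
  \<open>algebras_in_comm_prelie\<close>, \<open>C08_in_comm_prelie\<close> and \<open>orbit_subset_comm_prelie\<close> below.\<close>

definition orbit_closure :: "bilpair \<Rightarrow> bilpair set" where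
  "orbit_closure A = subtopology zariski comm_prelie closure_of orbit A"

definition family_closure :: "(complex \<Rightarrow> bilpair) \<Rightarrow> bilpair set" where
  "family_closure C = subtopology zariski comm_prelie closure_of (\<Union>\<alpha>. orbit (C \<alpha>))"

lemma orbit_subset_comm_prelie:
  assumes "A \<in> comm_prelie"
  shows "orbit A \<subseteq> comm_prelie"
proof
  fix B assume "B \<in> orbit A"
  then obtain g where g: "invertible g" and B: "B = gl_act g A"
    unfolding orbit_def by blast
  obtain m p where A: "A = (m, p)" by fastforce
  have inv: "matrix_inv g *v (g *v x) = x" for x
    using g someI_ex[of "\<lambda>h. g ** h = mat 1 \<and> h ** g = mat 1"]
    by (simp add: matrix_vector_mul_assoc invertible_def matrix_inv_def)
  have lin: "complex_bilinear (\<lambda>x y. g *v q (matrix_inv g *v x) (matrix_inv g *v y))"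
    if "complex_bilinear q" for q
  proof -
    have 1: "Vector_Spaces.linear (*s) (*s) ((*v) h)" for h :: "complex ^ 2 ^ 2"
      by (rule matrix_vector_mul_linear_gen)
    have 2: "Vector_Spaces.linear (*s) (*s) (\<lambda>x. g *v f (matrix_inv g *v x))"
      if "Vector_Spaces.linear (*s) (*s) f" for f
      using Vector_Spaces.linear_compose[OF Vector_Spaces.linear_compose[OF 1 that] 1]
      by (simp add: o_def)
    show ?thesis
      using that 2 unfolding complex_bilinear_def by auto
  qed
  have gl: "B = (\<lambda>x y. g *v m (matrix_inv g *v x) (matrix_inv g *v y),
      \<lambda>x y. g *v p (matrix_inv g *v x) (matrix_inv g *v y))"
    unfolding B A gl_act_def by simp
  have mp: "complex_bilinear m" "complex_bilinear p"
    "\<And>x y. m x y = m y x"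
    "\<And>x y z. m (m x y) z = m x (m y z)"
    "\<And>x y z. p (p x y) z - p (p y x) z = p x (p y z) - p y (p x z)"
    "\<And>x y z. p x (m y z) = m (p x y) z + m y (p x z)"
    using assms unfolding A comm_prelie_def mem_Collect_eq prod.case by blast+
  show "B \<in> comm_prelie"
    unfolding gl comm_prelie_def mem_Collect_eq prod.case inv
  proof (intro conjI allI)
    show "complex_bilinear (\<lambda>x y. g *v m (matrix_inv g *v x) (matrix_inv g *v y))"
      "complex_bilinear (\<lambda>x y. g *v p (matrix_inv g *v x) (matrix_inv g *v y))"
      using lin mp(1,2) by blast+
    fix x y z
    let ?x = "matrix_inv g *v x" and ?y = "matrix_inv g *v y" and ?z = "matrix_inv g *v z"
    show "g *v m ?x ?y = g *v m ?y ?x"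
      by (simp only: mp(3)[of ?x ?y])
    show "g *v m (m ?x ?y) ?z = g *v m ?x (m ?y ?z)"
      by (simp only: mp(4))
    show "g *v p (p ?x ?y) ?z - g *v p (p ?y ?x) ?z = g *v p ?x (p ?y ?z) - g *v p ?y (p ?x ?z)"
      by (simp only: mp(5) flip: matrix_vector_mult_diff_distrib)
    show "g *v p ?x (m ?y ?z) = g *v m (p ?x ?y) ?z + g *v m ?y (p ?x ?z)"
      by (simp only: mp(6) flip: matrix_vector_right_distrib)
  qed
qed

section \<open>The algebras\<close>

definition C01 :: bilpair where
  "C01 = (bilmap 0 0 0 0, bilmap (e1 + e2) 0 e2 0)"

definition C02 :: bilpair where
  "C02 = (bilmap 0 0 0 0, bilmap (e1 + e2) e2 0 0)"

definition C03 :: bilpair where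
  "C03 = (bilmap 0 0 0 0, bilmap e2 0 0 0)"

definition C04 :: bilpair where
  "C04 = (bilmap 0 0 0 0, bilmap 0 0 e1 0)"

definition C05 :: "complex \<Rightarrow> bilpair" where
  "C05 \<alpha> = (bilmap 0 0 0 0, bilmap e1 (\<alpha> *s e2) 0 0)"

definition C06 :: "complex \<Rightarrow> bilpair" where
  "C06 \<alpha> = (bilmap 0 0 0 0, bilmap e1 (\<alpha> *s e2) e2 0)"

definition C08 :: bilpair where
  "C08 = (bilmap 0 0 0 0, bilmap e1 (2 *s e2) ((1/2) *s e1 + e2) e2)"

definition C10 :: "complex \<Rightarrow> bilpair" where
  "C10 \<alpha> = (bilmap e1 e2 e2 0, bilmap 0 (\<alpha> *s e2) 0 0)"

definition C12 :: "complex \<Rightarrow> bilpair" where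
  "C12 \<alpha> = (bilmap e1 0 0 0, bilmap 0 (\<alpha> *s e2) 0 0)"

definition C15 :: "complex \<Rightarrow> bilpair" where
  "C15 \<alpha> = (bilmap e2 0 0 0, bilmap (\<alpha> *s e1) ((2 * \<alpha>) *s e2) (e1 + \<alpha> *s e2) (2 *s e2))"

definition C16 :: bilpair where
  "C16 = (bilmap e2 0 0 0, bilmap e1 (2 *s e2) e2 0)"

definition C17 :: "complex \<Rightarrow> bilpair" where
  "C17 \<alpha> = (bilmap e2 0 0 0, bilmap (\<alpha> *s e2) 0 0 0)"

definition C_zero :: bilpair where
  "C_zero = (bilmap 0 0 0 0, bilmap 0 0 0 0)"

lemma C08_in_comm_prelie: "C08 \<in> comm_prelie"
proof -
  define p where "p = bilmap e1 (2 *s e2) ((1/2) *s e1 + e2) e2"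
  have p: "p u v $ 1 = (u $ 1 + u $ 2 / 2) * v $ 1"
    "p u v $ 2 = (2 * u $ 1 + u $ 2) * v $ 2 + u $ 2 * v $ 1" for u v
    unfolding p_def bilmap_def axis_def
    by (simp_all add: algebra_simps)
  have bil: "complex_bilinear p"
    unfolding p_def by (rule complex_bilinear_bilmap)
  have "p (p x y) z - p (p y x) z = p x (p y z) - p y (p x z)" for x y z
  proof -
    define a b c where abc: "a = x $ 2 / 2" "b = y $ 2 / 2" "c = z $ 1 / 2"
    have x2: "x $ 2 = 2 * a" "y $ 2 = 2 * b" "z $ 1 = 2 * c"
      by (simp_all add: abc)
    have "(p (p x y) z - p (p y x) z) $ 1 = (p x (p y z) - p y (p x z)) $ 1"
      by (simp add: p x2) algebra
    moreover have "(p (p x y) z - p (p y x) z) $ 2 = (p x (p y z) - p y (p x z)) $ 2"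
      by (simp add: p x2) algebra
    ultimately show ?thesis
      by (simp only: vec_eq_iff forall_2)
  qed
  moreover have "bilmap 0 0 0 0 = (\<lambda>x y. 0)"
    by (simp add: bilmap_def fun_eq_iff)
  moreover have "p x 0 = 0" for x
    by (simp add: vec_eq_iff forall_2 p)
  ultimately show ?thesis
    using bil complex_bilinear_bilmap[of 0 0 0 0]
    unfolding C08_def comm_prelie_def p_def[symmetric] by simp
qed

lemma algebras_in_comm_prelie:
  "C01 \<in> comm_prelie" "C02 \<in> comm_prelie" "C03 \<in> comm_prelie" "C04 \<in> comm_prelie"
  "C05 \<alpha> \<in> comm_prelie" "C06 \<alpha> \<in> comm_prelie" "C10 \<alpha> \<in> comm_prelie" "C12 \<alpha> \<in> comm_prelie"
  "C15 \<alpha> \<in> comm_prelie" "C16 \<in> comm_prelie" "C17 \<alpha> \<in> comm_prelie" "C_zero \<in> comm_prelie"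
  unfolding C01_def C02_def C03_def C04_def C05_def C06_def C10_def C12_def C15_def C16_def C17_def
    C_zero_def comm_prelie_def
  by (simp add: complex_bilinear_bilmap bilmap_def axis_def vec_eq_iff forall_2;
      intro allI conjI; algebra)+

end

theory Submission
  imports Defs
begin

text \<open>Each inclusion comes from a curve \<open>t \<mapsto> B t\<close> of structures, continuous at \<open>t = 0\<close>, with \<open>B t\<close>
  in one of the orbits of the family for \<open>t \<noteq> 0\<close> and \<open>B 0\<close> the algebra to be reached. Polynomial
  functions are continuous along the curve, so \<open>B 0\<close> lies in the Zariski closure; translating the
  curve by \<open>g \<in> GL(V)\<close> gives the whole orbit of \<open>B 0\<close>, and hence its closure. The curve is given by
  a basis \<open>E1 t, E2 t\<close>, the columns of a matrix \<open>h t\<close>, and a parameter \<open>\<alpha> t\<close>, such that the structure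
  constants of \<open>C (\<alpha> t)\<close> in this basis are polynomials in \<open>t\<close>.\<close>

section \<open>Base change and orbits\<close>

lemma matrix_inv_vector_cancel:
  fixes h :: "'a::semiring_1 ^ 'n ^ 'n"
  assumes "invertible h"
  shows "h *v (matrix_inv h *v x) = x" "matrix_inv h *v (h *v x) = x"
  using assms someI_ex[of "\<lambda>k. h ** k = mat 1 \<and> k ** h = mat 1"]
  by (simp_all add: matrix_vector_mul_assoc invertible_def matrix_inv_def)

lemma invertible_matrix_inv:
  fixes h :: "'a::semiring_1 ^ 'n ^ 'n"
  assumes "invertible h"
  shows "invertible (matrix_inv h)"
  using assms someI_ex[of "\<lambda>k. h ** k = mat 1 \<and> k ** h = mat 1"]
  unfolding invertible_def matrix_inv_def by blast

text \<open>The columns of \<open>h\<close> are a new basis in which \<open>(m, p)\<close> becomes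
  \<open>(m', p')\<close>; the acting element is \<open>matrix_inv h\<close>. In this form the
  explicit curves below need no inverse matrices.\<close>

lemma orbitI:
  assumes h: "invertible h"
    and m: "\<And>x y. h *v m' x y = m (h *v x) (h *v y)"
    and p: "\<And>x y. h *v p' x y = p (h *v x) (h *v y)"
  shows "(m', p') \<in> orbit (m, p)"
proof -
  have g: "invertible (matrix_inv h)"
    using h by (rule invertible_matrix_inv)
  have inv_inv: "matrix_inv (matrix_inv h) *v x = h *v x" for x
    by (metis matrix_inv_vector_cancel g h)
  have "matrix_inv h *v m (h *v x) (h *v y) = m' x y"
    "matrix_inv h *v p (h *v x) (h *v y) = p' x y" for x y
    by (simp_all add: matrix_inv_vector_cancel[OF h] flip: m p)
  then have "gl_act (matrix_inv h) (m, p) = (m', p')"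
    by (simp add: gl_act_def inv_inv)
  then show ?thesis
    unfolding orbit_def using g by (intro CollectI exI[of _ "matrix_inv h"]) simp
qed

lemma gl_act_orbit:
  assumes "B \<in> orbit A" "invertible g"
  shows "gl_act g B \<in> orbit A"
proof -
  obtain m p where A: "A = (m, p)" by fastforce
  obtain k where k: "invertible k" "B = gl_act k A"
    using assms(1) unfolding orbit_def by blast
  note cancel = matrix_inv_vector_cancel[OF k(1)] matrix_inv_vector_cancel[OF assms(2)]
  \<comment> \<open>This is the inverse of \<open>g ** k\<close>, as \<open>orbitI\<close> takes the
    inverse of the acting element.\<close>
  have inv: "invertible (matrix_inv k ** matrix_inv g)"
    using assms(2) k(1) by (simp add: invertible_matrix_inv invertible_mult)
  show ?thesis
    unfolding k(2) A gl_act_def prod.case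
    by (rule orbitI[OF inv]) (simp_all only: cancel matrix_vector_mul_assoc[symmetric])
qed

section \<open>Limits of curves and the Zariski closure\<close>

lemma tendsto_matrix_vector_mult:
  fixes g :: "'a::real_normed_algebra_1 ^ 'n ^ 'm"
  assumes "\<And>k. ((\<lambda>t. v t $ k) \<longlongrightarrow> w $ k) F"
  shows "((\<lambda>t. (g *v v t) $ k) \<longlongrightarrow> (g *v w) $ k) F"
  unfolding matrix_vector_mult_def by simp (intro tendsto_intros assms)

lemma poly_fun_tendsto:
  assumes "poly_fun f"
    and "\<And>x y k. ((\<lambda>t. fst (B t) x y $ k) \<longlongrightarrow> fst A x y $ k) F"
    and "\<And>x y k. ((\<lambda>t. snd (B t) x y $ k) \<longlongrightarrow> snd A x y $ k) F"
  shows "((\<lambda>t. f (B t)) \<longlongrightarrow> f A) F"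
  using assms(1) by induction (assumption | intro tendsto_intros assms(2,3))+

text \<open>Inside the variety, a Zariski neighbourhood of \<open>A\<close> contains the
  nonvanishing locus of some polynomial \<open>f\<close> with \<open>f A \<noteq> 0\<close>. By
  continuity \<open>f (B t)\<close> is eventually nonzero, so \<open>B\<close> enters the
  neighbourhood.\<close>

lemma limit_in_closure_of:
  assumes "F \<noteq> bot" and "A \<in> comm_prelie" and "S \<subseteq> comm_prelie"
    and "eventually (\<lambda>t. B t \<in> S) F"
    and "\<And>x y k. ((\<lambda>t. fst (B t) x y $ k) \<longlongrightarrow> fst A x y $ k) F"
    and "\<And>x y k. ((\<lambda>t. snd (B t) x y $ k) \<longlongrightarrow> snd A x y $ k) F"
  shows "A \<in> subtopology zariski comm_prelie closure_of S"
proof -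
  have sub: "comm_prelie \<subseteq> bil_pairs"
    unfolding comm_prelie_def bil_pairs_def by blast
  have "\<exists>y\<in>S. y \<in> T" if AT: "A \<in> T" and T: "openin (subtopology zariski comm_prelie) T" for T
  proof -
    obtain G where G: "G \<subseteq> Collect poly_fun" "T = (bil_pairs - zero_locus G) \<inter> comm_prelie"
      using T unfolding openin_subtopology openin_zariski by blast
    then obtain f where f: "f \<in> G" "f A \<noteq> 0"
      using AT unfolding zero_locus_def by blast
    have "((\<lambda>t. f (B t)) \<longlongrightarrow> f A) F"
      using poly_fun_tendsto[OF _ assms(5,6)] f(1) G(1) by blast
    then have "eventually (\<lambda>t. f (B t) \<noteq> 0) F"
      using f(2) by (rule tendsto_imp_eventually_ne)
    with assms(4) have "eventually (\<lambda>t. f (B t) \<noteq> 0 \<and> B t \<in> S) F"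
      by eventually_elim simp
    then obtain t where "f (B t) \<noteq> 0" "B t \<in> S"
      using assms(1) eventually_happens' by blast
    moreover have "B t \<in> T"
      using calculation f(1) assms(3) sub unfolding G(2) zero_locus_def by blast
    ultimately show ?thesis by blast
  qed
  then show ?thesis
    using assms(2) sub unfolding in_closure_of topspace_subtopology topspace_zariski by blast
qed

lemma orbit_closure_subset_family_closure:
  fixes B :: "complex \<Rightarrow> bilpair"
  assumes C: "\<And>\<alpha>. C \<alpha> \<in> comm_prelie" and B0: "B 0 \<in> comm_prelie"
    and orb: "\<And>t. t \<noteq> 0 \<Longrightarrow> B t \<in> orbit (C (\<alpha> t))"
    and cont: "\<And>x y k. isCont (\<lambda>t. fst (B t) x y $ k) 0"
      "\<And>x y k. isCont (\<lambda>t. snd (B t) x y $ k) 0"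
  shows "orbit_closure (B 0) \<subseteq> family_closure C"
proof -
  let ?S = "\<Union>\<alpha>. orbit (C \<alpha>)"
  have S: "?S \<subseteq> comm_prelie"
    using orbit_subset_comm_prelie C by blast
  \<comment> \<open>The family closure is closed, so containing the orbit is enough.\<close>
  have "orbit (B 0) \<subseteq> family_closure C"
  proof
    fix D assume D: "D \<in> orbit (B 0)"
    then obtain g where g: "invertible g" "D = gl_act g (B 0)"
      unfolding orbit_def by blast
    have "eventually (\<lambda>t. gl_act g (B t) \<in> ?S) (at 0)"
      using gl_act_orbit[OF orb g(1)] by (auto simp: eventually_at_filter intro!: eventuallyI)
    moreover have "((\<lambda>t. fst (gl_act g (B t)) x y $ k) \<longlongrightarrow> fst (gl_act g (B 0)) x y $ k) (at 0)"
      "((\<lambda>t. snd (gl_act g (B t)) x y $ k) \<longlongrightarrow> snd (gl_act g (B 0)) x y $ k) (at 0)" for x y k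
      unfolding gl_act_def case_prod_beta fst_conv snd_conv
      by (rule tendsto_matrix_vector_mult, rule cont[unfolded isCont_def])+
    moreover have "gl_act g (B 0) \<in> comm_prelie"
      using D g(2) orbit_subset_comm_prelie[OF B0] by blast
    ultimately show "D \<in> family_closure C"
      unfolding family_closure_def g(2)
      using limit_in_closure_of[OF at_neq_bot _ S, where B = "\<lambda>t. gl_act g (B t)"] by blast
  qed
  then show ?thesis
    unfolding orbit_closure_def family_closure_def by (simp add: closure_of_minimal)
qed

text \<open>Here \<open>E1 = (a, c)\<close> and \<open>E2 = (b, d)\<close>.\<close>

lemma degeneration:
  fixes a b c d :: "complex \<Rightarrow> complex" and h :: "complex \<Rightarrow> complex ^ 2 ^ 2"
  defines "h \<equiv> \<lambda>t. vector [vector [a t, b t], vector [c t, d t]]"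
  assumes C: "\<And>\<alpha>. C \<alpha> \<in> comm_prelie" "A \<in> comm_prelie"
    and A: "A = (m 0, p 0)"
    and det: "\<And>t. t \<noteq> 0 \<Longrightarrow> a t * d t - b t * c t \<noteq> 0"
    and m: "\<And>t x y. t \<noteq> 0 \<Longrightarrow> h t *v m t x y = fst (C (\<alpha> t)) (h t *v x) (h t *v y)"
    and p: "\<And>t x y. t \<noteq> 0 \<Longrightarrow> h t *v p t x y = snd (C (\<alpha> t)) (h t *v x) (h t *v y)"
    and cont: "\<And>x y k. isCont (\<lambda>t. m t x y $ k) 0" "\<And>x y k. isCont (\<lambda>t. p t x y $ k) 0"
  shows "orbit_closure A \<subseteq> family_closure C"
  unfolding A
proof (rule orbit_closure_subset_family_closure[of C "\<lambda>t. (m t, p t)" \<alpha>])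
  fix t :: complex assume t: "t \<noteq> 0"
  \<comment> \<open>\<open>h 0\<close> may be singular: base change is used only for
    \<open>t \<noteq> 0\<close>, and \<open>A\<close> is reached by continuity of \<open>m\<close>
    and \<open>p\<close>.\<close>
  have "invertible (h t)"
    using det[OF t] by (simp add: invertible_det_nz det_2 h_def)
  then have "(m t, p t) \<in> orbit (fst (C (\<alpha> t)), snd (C (\<alpha> t)))"
    using m[OF t] p[OF t] by (rule orbitI)
  then show "(m t, p t) \<in> orbit (C (\<alpha> t))"
    by simp
qed (use C cont in \<open>simp_all only: A fst_conv snd_conv\<close>)

lemma bilmap_component:
  "bilmap a b c d x y $ k =
     x $ 1 * y $ 1 * a $ k + x $ 1 * y $ 2 * b $ k + x $ 2 * y $ 1 * c $ k + x $ 2 * y $ 2 * d $ k"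
  by (simp add: bilmap_def)

lemma matrix_2_vector_component:
  fixes a b c d :: "'a::semiring_1" and x :: "'a ^ 2"
  shows "((vector [vector [a, b], vector [c, d]] :: 'a ^ 2 ^ 2) *v x) $ 1 = a * x $ 1 + b * x $ 2"
    "((vector [vector [a, b], vector [c, d]] :: 'a ^ 2 ^ 2) *v x) $ 2 = c * x $ 1 + d * x $ 2"
  by (simp_all add: matrix_vector_mult_def sum_2)

lemmas degeneration_simps = vec_eq_iff forall_2 matrix_2_vector_component bilmap_component

lemma complex_bilinear_scale:
  assumes "complex_bilinear m"
  shows "m (s *s x) (t *s y) = s *s (t *s m x y)"
proof -
  have "Vector_Spaces.linear (*s) (*s) (m x)"
    "Vector_Spaces.linear (*s) (*s) (\<lambda>x. m x (t *s y))"
    using assms unfolding complex_bilinear_def by blast+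
  from this[THEN vec.linear_scale] show ?thesis
    by simp
qed

text \<open>In the basis \<open>t e1, t e2\<close> bilinearity multiplies both products by
  \<open>t\<close>, so a single member of the family suffices; the one at parameter 0 is
  taken.\<close>

lemma C_zero_degeneration:
  assumes C: "\<And>\<alpha>. C \<alpha> \<in> comm_prelie"
  shows "orbit_closure C_zero \<subseteq> family_closure C"
proof (rule degeneration[OF C algebras_in_comm_prelie(12), where \<alpha> = "\<lambda>t. 0" and
      a = "\<lambda>t. t" and b = "\<lambda>t. 0" and c = "\<lambda>t. 0" and d = "\<lambda>t. t" and
      m = "\<lambda>t x y. t *s fst (C 0) x y" and p = "\<lambda>t x y. t *s snd (C 0) x y"])
  have h: "(vector [vector [t, 0], vector [0, t]] :: complex ^ 2 ^ 2) *v x = t *s x" for t x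
    by (simp add: degeneration_simps)
  have "complex_bilinear (fst (C 0))" "complex_bilinear (snd (C 0))"
    using C[of 0] by (auto simp: comm_prelie_def)
  note scale = this[THEN complex_bilinear_scale]
  fix t :: complex and x y :: V
  show "(vector [vector [t, 0], vector [0, t]] :: complex ^ 2 ^ 2) *v (t *s fst (C 0) x y) =
      fst (C 0) ((vector [vector [t, 0], vector [0, t]] :: complex ^ 2 ^ 2) *v x)
        ((vector [vector [t, 0], vector [0, t]] :: complex ^ 2 ^ 2) *v y)"
    "(vector [vector [t, 0], vector [0, t]] :: complex ^ 2 ^ 2) *v (t *s snd (C 0) x y) =
      snd (C 0) ((vector [vector [t, 0], vector [0, t]] :: complex ^ 2 ^ 2) *v x)
        ((vector [vector [t, 0], vector [0, t]] :: complex ^ 2 ^ 2) *v y)"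
    by (simp_all only: h scale)
qed (simp_all add: C_zero_def bilmap_def fun_eq_iff)

section \<open>Degenerations of \<open>C05\<close> and \<open>C06\<close>\<close>

text \<open>The growth of \<open>\<alpha> = 1 / t\<close> offsets \<open>E2 = t e1\<close>, so
  \<open>E2 \<circ> E1 = E1\<close> with \<open>E1 = e2\<close>, while
  \<open>E2 \<circ> E2 = t E2\<close> dies out.\<close>

lemma C05_to_C04: "orbit_closure C04 \<subseteq> family_closure C05"
  by (rule degeneration[OF algebras_in_comm_prelie(5) algebras_in_comm_prelie(4), where
        \<alpha> = "\<lambda>t. 1 / t" and
        a = "\<lambda>t. 0" and b = "\<lambda>t. t" and c = "\<lambda>t. 1" and d = "\<lambda>t. 0" and
        m = "\<lambda>t. bilmap 0 0 0 0" and
        p = "\<lambda>t. bilmap 0 0 e1 (t *s e2)"])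
    (simp_all add: C05_def C04_def degeneration_simps axis_def field_simps
      power2_eq_square power3_eq_cube)

text \<open>For \<open>E1 = t e1 + e2\<close> one has
  \<open>E1 \<circ> E1 = t E1 + (\<alpha> - 1) t e2\<close>; \<open>\<alpha> = 2\<close> turns the
  last term into \<open>E2\<close>.\<close>

lemma C05_to_C03: "orbit_closure C03 \<subseteq> family_closure C05"
  by (rule degeneration[OF algebras_in_comm_prelie(5) algebras_in_comm_prelie(3), where
        \<alpha> = "\<lambda>t. 2" and
        a = "\<lambda>t. t" and b = "\<lambda>t. 0" and c = "\<lambda>t. 1" and d = "\<lambda>t. t" and
        m = "\<lambda>t. bilmap 0 0 0 0" and
        p = "\<lambda>t. bilmap (t *s e1 + e2) ((2 * t) *s e2) 0 0"])
    (simp_all add: C05_def C03_def degeneration_simps axis_def field_simps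
      power2_eq_square power3_eq_cube)

text \<open>Left multiplication by \<open>e1\<close> has eigenvalues 1 and \<open>\<alpha>\<close>;
  as they merge, the sheared basis keeps a Jordan block in the limit.\<close>

lemma C05_to_C02: "orbit_closure C02 \<subseteq> family_closure C05"
  by (rule degeneration[OF algebras_in_comm_prelie(5) algebras_in_comm_prelie(2), where
        \<alpha> = "\<lambda>t. 1 + t" and
        a = "\<lambda>t. 1" and b = "\<lambda>t. 0" and c = "\<lambda>t. 1" and d = "\<lambda>t. t" and
        m = "\<lambda>t. bilmap 0 0 0 0" and
        p = "\<lambda>t. bilmap (e1 + e2) ((1 + t) *s e2) 0 0"])
    (simp_all add: C05_def C02_def degeneration_simps axis_def field_simps
      power2_eq_square power3_eq_cube)

lemma C06_to_C04: "orbit_closure C04 \<subseteq> family_closure C06"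
  by (rule degeneration[OF algebras_in_comm_prelie(6) algebras_in_comm_prelie(4), where
        \<alpha> = "\<lambda>t. 1 / t" and
        a = "\<lambda>t. 0" and b = "\<lambda>t. t" and c = "\<lambda>t. 1" and d = "\<lambda>t. 0" and
        m = "\<lambda>t. bilmap 0 0 0 0" and
        p = "\<lambda>t. bilmap 0 (t *s e1) e1 (t *s e2)"])
    (simp_all add: C06_def C04_def degeneration_simps axis_def field_simps
      power2_eq_square power3_eq_cube)

lemma C06_to_C03: "orbit_closure C03 \<subseteq> family_closure C06"
  by (rule degeneration[OF algebras_in_comm_prelie(6) algebras_in_comm_prelie(3), where
        \<alpha> = "\<lambda>t. 1" and
        a = "\<lambda>t. t" and b = "\<lambda>t. 0" and c = "\<lambda>t. 1" and d = "\<lambda>t. t" and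
        m = "\<lambda>t. bilmap 0 0 0 0" and
        p = "\<lambda>t. bilmap (t *s e1 + e2) (t *s e2) (t *s e2) 0"])
    (simp_all add: C06_def C03_def degeneration_simps axis_def field_simps
      power2_eq_square power3_eq_cube)

text \<open>For \<open>E1 = e1 + e2\<close> one has \<open>E1 \<circ> E1 = E1 + \<alpha> e2\<close>,
  so \<open>\<alpha> = t\<close> matches \<open>E2 = t e2\<close>.\<close>

lemma C06_to_C01: "orbit_closure C01 \<subseteq> family_closure C06"
  by (rule degeneration[OF algebras_in_comm_prelie(6) algebras_in_comm_prelie(1), where
        \<alpha> = "\<lambda>t. t" and
        a = "\<lambda>t. 1" and b = "\<lambda>t. 0" and c = "\<lambda>t. 1" and d = "\<lambda>t. t" and
        m = "\<lambda>t. bilmap 0 0 0 0" and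
        p = "\<lambda>t. bilmap (e1 + e2) (t *s e2) e2 0"])
    (simp_all add: C06_def C01_def degeneration_simps axis_def field_simps
      power2_eq_square power3_eq_cube)

section \<open>Degenerations of \<open>C10\<close> and \<open>C12\<close>\<close>

lemma C10_to_C17: "orbit_closure (C17 \<beta>) \<subseteq> family_closure C10"
  by (rule degeneration[OF algebras_in_comm_prelie(7) algebras_in_comm_prelie(11), where
        \<alpha> = "\<lambda>t. \<beta>" and
        a = "\<lambda>t. t" and b = "\<lambda>t. 0" and c = "\<lambda>t. 1" and d = "\<lambda>t. t" and
        m = "\<lambda>t. bilmap (t *s e1 + e2) (t *s e2) (t *s e2) 0" and
        p = "\<lambda>t. bilmap (\<beta> *s e2) ((t * \<beta>) *s e2) 0 0"])
    (simp_all add: C10_def C17_def degeneration_simps axis_def field_simps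
      power2_eq_square power3_eq_cube)

lemma C10_to_C04: "orbit_closure C04 \<subseteq> family_closure C10"
  by (rule degeneration[OF algebras_in_comm_prelie(7) algebras_in_comm_prelie(4), where
        \<alpha> = "\<lambda>t. 1 / t" and
        a = "\<lambda>t. 0" and b = "\<lambda>t. t" and c = "\<lambda>t. 1" and d = "\<lambda>t. 0" and
        m = "\<lambda>t. bilmap 0 (t *s e1) (t *s e1) (t *s e2)" and
        p = "\<lambda>t. bilmap 0 0 e1 0"])
    (simp_all add: C10_def C04_def degeneration_simps axis_def field_simps
      power2_eq_square power3_eq_cube)

text \<open>With \<open>E1 = t\<^sup>2 e1 + e2\<close> the pre-Lie square is
  \<open>\<alpha> t\<^sup>2 e2 = E2\<close>, whereas the commutative square has only
  \<open>t\<^sup>2 e2 = t E2\<close> beside \<open>t\<^sup>2 E1\<close>.\<close>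

lemma C10_to_C03: "orbit_closure C03 \<subseteq> family_closure C10"
  by (rule degeneration[OF algebras_in_comm_prelie(7) algebras_in_comm_prelie(3), where
        \<alpha> = "\<lambda>t. 1 / t" and
        a = "\<lambda>t. t\<^sup>2" and b = "\<lambda>t. 0" and c = "\<lambda>t. 1" and d = "\<lambda>t. t" and
        m = "\<lambda>t. bilmap (t\<^sup>2 *s e1 + t *s e2) (t\<^sup>2 *s e2) (t\<^sup>2 *s e2) 0" and
        p = "\<lambda>t. bilmap e2 (t *s e2) 0 0"])
    (simp_all add: C10_def C03_def degeneration_simps axis_def field_simps
      power2_eq_square power3_eq_cube)

text \<open>Here \<open>e1 \<cdot> e2 = 0\<close>, so the square of \<open>E1 = t e1 + e2\<close> is
  \<open>t E1 - t e2\<close>; this forces \<open>E2 = - t e2\<close>, hence the sign of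
  \<open>\<alpha>\<close>.\<close>

lemma C12_to_C17: "orbit_closure (C17 \<beta>) \<subseteq> family_closure C12"
  by (rule degeneration[OF algebras_in_comm_prelie(8) algebras_in_comm_prelie(11), where
        \<alpha> = "\<lambda>t. - \<beta>" and
        a = "\<lambda>t. t" and b = "\<lambda>t. 0" and c = "\<lambda>t. 1" and d = "\<lambda>t. - t" and
        m = "\<lambda>t. bilmap (t *s e1 + e2) 0 0 0" and
        p = "\<lambda>t. bilmap (\<beta> *s e2) ((- t * \<beta>) *s e2) 0 0"])
    (simp_all add: C12_def C17_def degeneration_simps axis_def field_simps
      power2_eq_square power3_eq_cube)

lemma C12_to_C04: "orbit_closure C04 \<subseteq> family_closure C12"
  by (rule degeneration[OF algebras_in_comm_prelie(8) algebras_in_comm_prelie(4), where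
        \<alpha> = "\<lambda>t. 1 / t" and
        a = "\<lambda>t. 0" and b = "\<lambda>t. t" and c = "\<lambda>t. 1" and d = "\<lambda>t. 0" and
        m = "\<lambda>t. bilmap 0 0 0 (t *s e2)" and
        p = "\<lambda>t. bilmap 0 0 e1 0"])
    (simp_all add: C12_def C04_def degeneration_simps axis_def field_simps
      power2_eq_square power3_eq_cube)

lemma C12_to_C03: "orbit_closure C03 \<subseteq> family_closure C12"
  by (rule degeneration[OF algebras_in_comm_prelie(8) algebras_in_comm_prelie(3), where
        \<alpha> = "\<lambda>t. 1 / t" and
        a = "\<lambda>t. t\<^sup>2" and b = "\<lambda>t. 0" and c = "\<lambda>t. 1" and d = "\<lambda>t. t" and
        m = "\<lambda>t. bilmap (t\<^sup>2 *s e1 + (- t) *s e2) 0 0 0" and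
        p = "\<lambda>t. bilmap e2 (t *s e2) 0 0"])
    (simp_all add: C12_def C03_def degeneration_simps axis_def field_simps
      power2_eq_square power3_eq_cube)

section \<open>Degenerations of \<open>C15\<close> and \<open>C17\<close>\<close>

text \<open>For \<open>E1 = t (e1 + e2)\<close> and \<open>E2 = t\<^sup>2 e2\<close>, the
  \<open>E2\<close>-coefficient of \<open>E1 \<circ> E1\<close> is \<open>2 \<alpha> + 1\<close>,
  which is set to \<open>\<beta>\<close>.\<close>

lemma C15_to_C17: "orbit_closure (C17 \<beta>) \<subseteq> family_closure C15"
  by (rule degeneration[OF algebras_in_comm_prelie(9) algebras_in_comm_prelie(11), where
        \<alpha> = "\<lambda>t. (\<beta> - 1) / 2" and
        a = "\<lambda>t. t" and b = "\<lambda>t. 0" and c = "\<lambda>t. t" and d = "\<lambda>t. t\<^sup>2" and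
        m = "\<lambda>t. bilmap e2 0 0 0" and
        p = "\<lambda>t. bilmap ((t * (\<beta> + 1) / 2) *s e1 + \<beta> *s e2) ((t * (\<beta> + 1)) *s e2)
        (t\<^sup>2 *s e1 + (t * (\<beta> + 1) / 2) *s e2) ((2 * t\<^sup>2) *s e2)"])
    (simp_all add: C15_def C17_def degeneration_simps axis_def field_simps
      power2_eq_square power3_eq_cube)

text \<open>Weights 1 and 2 preserve \<open>e1 \<cdot> e1 = e2\<close>, and
  \<open>\<alpha> = 1 / t\<close> normalises \<open>E1 \<circ> E1\<close> to
  \<open>E1\<close>.\<close>

lemma C15_to_C16: "orbit_closure C16 \<subseteq> family_closure C15"
  by (rule degeneration[OF algebras_in_comm_prelie(9) algebras_in_comm_prelie(10), where
        \<alpha> = "\<lambda>t. 1 / t" and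
        a = "\<lambda>t. t" and b = "\<lambda>t. 0" and c = "\<lambda>t. 0" and d = "\<lambda>t. t\<^sup>2" and
        m = "\<lambda>t. bilmap e2 0 0 0" and
        p = "\<lambda>t. bilmap e1 (2 *s e2) (t\<^sup>2 *s e1 + e2) ((2 * t\<^sup>2) *s e2)"])
    (simp_all add: C15_def C16_def degeneration_simps axis_def field_simps
      power2_eq_square power3_eq_cube)

text \<open>The pre-Lie product is that of \<open>C08\<close> all along the curve; only the
  commutative one shrinks.\<close>

lemma C15_to_C08: "orbit_closure C08 \<subseteq> family_closure C15"
  by (rule degeneration[OF algebras_in_comm_prelie(9) C08_in_comm_prelie, where
        \<alpha> = "\<lambda>t. 1 / t" and
        a = "\<lambda>t. t" and b = "\<lambda>t. 0" and c = "\<lambda>t. 0" and d = "\<lambda>t. 1 / 2" and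
        m = "\<lambda>t. bilmap ((2 * t\<^sup>2) *s e2) 0 0 0" and
        p = "\<lambda>t. bilmap e1 (2 *s e2) ((1/2) *s e1 + e2) e2"])
    (simp_all add: C15_def C08_def degeneration_simps axis_def field_simps
      power2_eq_square power3_eq_cube)

lemma C15_to_C06: "orbit_closure (C06 2) \<subseteq> family_closure C15"
  by (rule degeneration[OF algebras_in_comm_prelie(9) algebras_in_comm_prelie(6), where
        \<alpha> = "\<lambda>t. 1 / t" and
        a = "\<lambda>t. t" and b = "\<lambda>t. 0" and c = "\<lambda>t. 0" and d = "\<lambda>t. t" and
        m = "\<lambda>t. bilmap (t *s e2) 0 0 0" and
        p = "\<lambda>t. bilmap e1 (2 *s e2) (t *s e1 + e2) ((2 * t) *s e2)"])
    (simp_all add: C15_def C06_def degeneration_simps axis_def field_simps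
      power2_eq_square power3_eq_cube)

text \<open>\<open>e2 / 2\<close> is idempotent for \<open>\<circ>\<close>, so it becomes
  \<open>E1\<close>; \<open>E2 = t e1\<close> shrinks the commutative product only.\<close>

lemma C15_to_C05: "orbit_closure (C05 (1/2)) \<subseteq> family_closure C15"
  by (rule degeneration[OF algebras_in_comm_prelie(9) algebras_in_comm_prelie(5), where
        \<alpha> = "\<lambda>t. 0" and
        a = "\<lambda>t. 0" and b = "\<lambda>t. t" and c = "\<lambda>t. 1 / 2" and d = "\<lambda>t. 0" and
        m = "\<lambda>t. bilmap 0 0 0 ((2 * t\<^sup>2) *s e1)" and
        p = "\<lambda>t. bilmap e1 ((1/2) *s e2) 0 0"])
    (simp_all add: C15_def C05_def degeneration_simps axis_def field_simps
      power2_eq_square power3_eq_cube)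

text \<open>As for \<open>C17\<close>, but with \<open>2 \<alpha> + 1 = 1 / t\<close>:
  \<open>E2 = t\<^sup>3 e2\<close> then keeps the pre-Lie square and leaves
  \<open>E1 \<cdot> E1 = t E2\<close>.\<close>

lemma C15_to_C03: "orbit_closure C03 \<subseteq> family_closure C15"
  by (rule degeneration[OF algebras_in_comm_prelie(9) algebras_in_comm_prelie(3), where
        \<alpha> = "\<lambda>t. (1 / t - 1) / 2" and
        a = "\<lambda>t. t\<^sup>2" and b = "\<lambda>t. 0" and c = "\<lambda>t. t\<^sup>2" and d = "\<lambda>t. t ^ 3" and
        m = "\<lambda>t. bilmap (t *s e2) 0 0 0" and
        p = "\<lambda>t. bilmap ((t * (1 + t) / 2) *s e1 + e2) ((t * (1 + t)) *s e2)
        (t ^ 3 *s e1 + (t * (1 + t) / 2) *s e2) ((2 * t ^ 3) *s e2)"])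
    (simp_all add: C15_def C03_def degeneration_simps axis_def field_simps
      power2_eq_square power3_eq_cube)

lemma C17_to_C03: "orbit_closure C03 \<subseteq> family_closure C17"
  by (rule degeneration[OF algebras_in_comm_prelie(11) algebras_in_comm_prelie(3), where
        \<alpha> = "\<lambda>t. 1 / t" and
        a = "\<lambda>t. t" and b = "\<lambda>t. 0" and c = "\<lambda>t. 0" and d = "\<lambda>t. t" and
        m = "\<lambda>t. bilmap (t *s e2) 0 0 0" and
        p = "\<lambda>t. bilmap e2 0 0 0"])
    (simp_all add: C17_def C03_def degeneration_simps axis_def field_simps
      power2_eq_square power3_eq_cube)

theorem corollary51:
  shows
    "(\<forall>A \<in> {C04, C03, C02, C_zero}. orbit_closure A \<subseteq> family_closure C05) \<and>
     (\<forall>A \<in> {C04, C03, C01, C_zero}. orbit_closure A \<subseteq> family_closure C06) \<and>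
     (\<forall>A \<in> range C17 \<union> {C04, C03, C_zero}. orbit_closure A \<subseteq> family_closure C10) \<and>
     (\<forall>A \<in> range C17 \<union> {C04, C03, C_zero}. orbit_closure A \<subseteq> family_closure C12) \<and>
     (\<forall>A \<in> range C17 \<union> {C16, C08, C06 2, C05 (1/2), C03, C_zero}.
        orbit_closure A \<subseteq> family_closure C15) \<and>
     (\<forall>A \<in> {C03, C_zero}. orbit_closure A \<subseteq> family_closure C17)"
  by (simp add: ball_Un algebras_in_comm_prelie C_zero_degeneration
    C05_to_C04 C05_to_C03 C05_to_C02 C06_to_C04 C06_to_C03 C06_to_C01 C10_to_C17 C10_to_C04
    C10_to_C03 C12_to_C17 C12_to_C04 C12_to_C03 C15_to_C17 C15_to_C16 C15_to_C08 C15_to_C06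
    C15_to_C05 C15_to_C03 C17_to_C03)

end
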